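(* Let $(S,+)$ be a commutative semigroup and let $A\subseteq S$ be a $CR$-set. Then there exists $r\in\mathbb{N}$ such that $A-A$ is an $IP_r^{\star}$-set in $S$.
   Context: $\mathbb{N}=\{1,2,3,\dots\}$. A set $A\subseteq S$ is a combinatorially rich set ($CR$-set) if for each $k\in\mathbb{N}$ there exists $r\in\mathbb{N}$ such that whenever $M=(m_{i,j})$ is an $r\times k$ matrix with entries from $S$, there exist $a\in S$ and a nonempty $H\subseteq\{1,\dots,r\}$ such that for each $j\in\{1,\dots,k\}$, $a+\sum_{t\in H}m_{t,j}\in A$. For $A\subseteq S$, $A-A=\{s\in S:\text{there is } a\in A\text{ with } a+s\in A\}$. For $r\in\mathbb{N}$, a subset of $S$ is an $IP_r$-set if it contains $\{\sum_{n\in F}x_n:\emptyset\neq F\subseteq\{1,\dots,r\}\}$ for some finite sequence $(x_n)_{n=1}^{r}$ in $S$; a subset of $S$ is an $IP_r^{\star}$-set if it intersects every $IP_r$-set in $S$. *)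

theory Defs
  imports Main
begin

text \<open>
  A commutative semigroup is a type of class \<open>ab_semigroup_add\<close>.  Since there need not be a
  neutral element, \<open>sum\<close> is unavailable, and sums are only meaningful over nonempty finite sets:
  start with the term of least index and add the remaining ones.  The value for empty or
  infinite \<open>F\<close> is irrelevant.
\<close>

definition nsum :: "(nat \<Rightarrow> 'a::ab_semigroup_add) \<Rightarrow> nat set \<Rightarrow> 'a" where
  "nsum x F = Finite_Set.fold (\<lambda>i s. x i + s) (x (Min F)) (F - {Min F})"

lemma comp_fun_commute_add_term:
  fixes x :: "nat \<Rightarrow> 'a::ab_semigroup_add"
  shows "comp_fun_commute (\<lambda>i s. x i + s)"
  by standard (auto simp: fun_eq_iff add.left_commute)

lemma nsum_singleton [simp]: "nsum x {i} = x i"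
  by (simp add: nsum_def)

lemma nsum_insert:
  assumes "finite F" "F \<noteq> {}" "i \<notin> F"
  shows "nsum x (insert i F) = x i + nsum x F"
proof -
  interpret comp_fun_commute "\<lambda>i s. x i + s"
    by (rule comp_fun_commute_add_term)
  define m where "m = Min F"
  have m: "m \<in> F" "\<And>j. j \<in> F \<Longrightarrow> m \<le> j"
    using assms by (auto simp: m_def)
  show ?thesis
  proof (cases "m < i")
    case True
    then have "Min (insert i F) = m"
      using assms m by (intro Min_eqI) (auto intro: less_imp_le)
    moreover have "insert i F - {m} = insert i (F - {m})"
      using True by auto
    ultimately show ?thesis
      using assms by (simp add: nsum_def m_def[symmetric])
  next
    case False
    then have "Min (insert i F) = i"
      using assms m by (intro Min_eqI) (force dest: m(2))+
    moreover have "insert i F - {i} = F"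
      using assms by auto
    ultimately have "nsum x (insert i F) = Finite_Set.fold (\<lambda>i s. x i + s) (x i) F"
      by (simp add: nsum_def)
    also have "\<dots> = x m + Finite_Set.fold (\<lambda>i s. x i + s) (x i) (F - {m})"
      using m assms by (simp add: fold_rec)
    also have "\<dots> = Finite_Set.fold (\<lambda>i s. x i + s) (x m + x i) (F - {m})"
      using assms by (simp add: fold_fun_left_comm)
    also have "\<dots> = Finite_Set.fold (\<lambda>i s. x i + s) (x i + x m) (F - {m})"
      by (simp add: add.commute)
    also have "\<dots> = x i + Finite_Set.fold (\<lambda>i s. x i + s) (x m) (F - {m})"
      using assms by (simp add: fold_fun_left_comm)
    finally show ?thesis
      by (simp add: nsum_def m_def)
  qed
qed

lemma nsum_eq_sum:
  fixes x :: "nat \<Rightarrow> 'a::comm_monoid_add"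
  assumes "finite F" "F \<noteq> {}"
  shows "nsum x F = sum x F"
  using assms by (induction F rule: finite_ne_induct) (simp_all add: nsum_insert)

text \<open>
  An \<open>r \<times> k\<close> matrix is a function \<open>nat \<Rightarrow> nat \<Rightarrow> 'a\<close> (row, then column) of which only the
  entries with indices in \<open>{1..r}\<close> and \<open>{1..k}\<close> are used; likewise for sequences of length \<open>r\<close>.
\<close>

definition CR_set :: "'a::ab_semigroup_add set \<Rightarrow> bool" where
  "CR_set A \<longleftrightarrow>
     (\<forall>k\<ge>1. \<exists>r\<ge>1. \<forall>m :: nat \<Rightarrow> nat \<Rightarrow> 'a.
        \<exists>a H. H \<noteq> {} \<and> H \<subseteq> {1..r} \<and> (\<forall>j\<in>{1..k}. a + nsum (\<lambda>t. m t j) H \<in> A))"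

text \<open>The set \<open>A - A\<close> of the semigroup; not to be confused with set difference.\<close>

definition self_diff :: "'a::ab_semigroup_add set \<Rightarrow> 'a set" where
  "self_diff A = {s. \<exists>a\<in>A. a + s \<in> A}"

definition IP_set :: "nat \<Rightarrow> 'a::ab_semigroup_add set \<Rightarrow> bool" where
  "IP_set r B \<longleftrightarrow> (\<exists>x :: nat \<Rightarrow> 'a. {nsum x F | F. F \<noteq> {} \<and> F \<subseteq> {1..r}} \<subseteq> B)"

definition IP_star_set :: "nat \<Rightarrow> 'a::ab_semigroup_add set \<Rightarrow> bool" where
  "IP_star_set r B \<longleftrightarrow> (\<forall>C. IP_set r C \<longrightarrow> B \<inter> C \<noteq> {})"

end

theory Submission
  imports Defs
begin

text \<open>
  Given \<open>x\<^sub>1, \<dots>, x\<^sub>r\<close>, apply the \<open>CR\<close> property with \<open>k = 2\<close> to the matrix with rows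
  \<open>(x\<^sub>t, x\<^sub>t + x\<^sub>t)\<close>.  Writing \<open>s\<close> for the sum of the \<open>x\<^sub>t\<close> over \<open>t \<in> H\<close>, both \<open>a + s\<close> and
  \<open>(a + s) + s\<close> lie in \<open>A\<close>, so \<open>s\<close> is in \<open>A - A\<close>.
\<close>

text \<open>Commutativity allows the regrouping. With \<open>y = x\<close> it turns the sum of a
  doubled column into \<open>nsum x H + nsum x H\<close>.\<close>

lemma nsum_add:
  assumes "finite F" "F \<noteq> {}"
  shows "nsum (\<lambda>t. x t + y t) F = nsum x F + nsum y F"
  using assms by (induction F rule: finite_ne_induct) (simp_all add: nsum_insert ac_simps)

theorem corollary3p9:
  fixes A :: "'a::ab_semigroup_add set"
  assumes "CR_set A"
  shows "\<exists>r\<ge>1. IP_star_set r (self_diff A)"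
proof -
  have "\<exists>r\<ge>1. \<forall>m :: nat \<Rightarrow> nat \<Rightarrow> 'a.
      \<exists>a H. H \<noteq> {} \<and> H \<subseteq> {1..r} \<and> (\<forall>j\<in>{1..2}. a + nsum (\<lambda>t. m t j) H \<in> A)"
    by (rule assms[unfolded CR_set_def, THEN spec, THEN mp, OF one_le_numeral])
  then obtain r :: nat where "r \<ge> 1" and r: "\<forall>m :: nat \<Rightarrow> nat \<Rightarrow> 'a.
      \<exists>a H. H \<noteq> {} \<and> H \<subseteq> {1..r} \<and> (\<forall>j\<in>{1..2}. a + nsum (\<lambda>t. m t j) H \<in> A)"
    by (elim exE conjE)
  have "self_diff A \<inter> C \<noteq> {}" if C: "IP_set r C" for C
  proof -
    obtain x :: "nat \<Rightarrow> 'a" where x: "{nsum x F | F. F \<noteq> {} \<and> F \<subseteq> {1..r}} \<subseteq> C"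
      using C unfolding IP_set_def by (elim exE)
    \<comment> \<open>Columns \<open>0\<close> and \<open>x t\<close> would need a neutral element;
      with \<open>x t\<close> and \<open>x t + x t\<close> the second column still exceeds the first
      by \<open>x t\<close>.\<close>
    let ?m = "\<lambda>t j :: nat. if j = 1 then x t else x t + x t"
    obtain a H where H: "H \<noteq> {}" "H \<subseteq> {1..r}"
      and aH: "\<forall>j\<in>{1..2}. a + nsum (\<lambda>t. ?m t j) H \<in> A"
      using spec[OF r, of ?m] by (elim exE conjE)
    have "finite H"
      using H(2) by (rule finite_subset) simp
    have "a + nsum x H \<in> A"
      using bspec[OF aH, of 1] by simp
    moreover have "(a + nsum x H) + nsum x H \<in> A"
      using bspec[OF aH, of 2] \<open>finite H\<close> H(1) by (simp add: nsum_add add.assoc)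
    ultimately have "nsum x H \<in> self_diff A"
      unfolding self_diff_def by blast
    \<comment> \<open>\<open>H\<close> is a nonempty subset of \<open>{1..r}\<close>, so the
      \<open>r\<close> of the CR property also serves as the length of the IP sequence.\<close>
    moreover have "nsum x H \<in> C"
      using H by (intro subsetD[OF x] CollectI exI[of _ H]) simp
    ultimately show ?thesis
      by blast
  qed
  with \<open>r \<ge> 1\<close> show ?thesis
    unfolding IP_star_set_def by blast
qed

end
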